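(* In dimension $6$, every strictly balanced inequality for $h^*$-polynomials of lattice polytopes containing an interior lattice point can be deduced from the following inequalities: (1) $h^*_6\le h^*_1\le h^*_5\le h^*_2$; (2) $h^*_1+h^*_2\le h^*_4+h^*_5\le h^*_2+h^*_3$; (3) $h^*_1+h^*_2\le h^*_3+h^*_4$.
   Context: A lattice polytope is a polytope with vertices in $\mathbb{Z}^d$. For a $d$-dimensional lattice polytope $P\subseteq\mathbb{R}^d$, let $f_P(m)=|mP\cap\mathbb{Z}^d|$. Its $h^*$-polynomial $h^*(t)=h^*_0+h^*_1t+\cdots+h^*_dt^d$ is the polynomial of degree at most $d$ with $\sum_{m\ge0}f_P(m)t^m=\frac{h^*(t)}{(1-t)^{d+1}}$. A strictly balanced inequality (in dimension $d$) for $h^*$-polynomials of lattice polytopes containing an interior lattice point is an inequality $\sum_{i=1}^d\alpha_ih^*_i\ge0$ with real coefficients satisfying $\sum_{i=1}^d\alpha_i=0$ that holds for the $h^*$-polynomial of every $d$-dimensional lattice polytope $P\subseteq\mathbb{R}^d$ containing an interior lattice point. It can be deduced from a given system of linear inequalities in $h^*_1,\ldots,h^*_d$ if it holds for every real vector $(h^*_1,\ldots,h^*_d)$ satisfying the system. *)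

theory Defs
  imports "HOL-Analysis.Analysis" "HOL-Computational_Algebra.Polynomial_FPS"
begin

definition lattice_points :: "(real ^ 'n) set" where
  "lattice_points = {x. \<forall>i. x $ i \<in> \<int>}"

definition lattice_polytope :: "(real ^ 'n) set \<Rightarrow> bool" where
  "lattice_polytope P \<longleftrightarrow> polytope P \<and> (\<forall>v. v extreme_point_of P \<longrightarrow> v \<in> lattice_points)"

definition lattice_count :: "(real ^ 'n) set \<Rightarrow> nat \<Rightarrow> nat" where
  "lattice_count P m = card ((\<lambda>x. real m *\<^sub>R x) ` P \<inter> lattice_points)"

text \<open>
  The identity between generating functions is one of formal power series.
  The predicate is only meant for full-dimensional lattice polytopes; for these
  such an \<open>h\<close> exists by the theorems of Ehrhart and Stanley, and it is unique
  (\<open>is_h_star_poly_unique\<close>).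
\<close>

definition is_h_star_poly :: "real poly \<Rightarrow> (real ^ 'n) set \<Rightarrow> bool" where
  "is_h_star_poly h P \<longleftrightarrow>
     degree h \<le> CARD('n) \<and>
     Abs_fps (\<lambda>m. real (lattice_count P m)) = fps_of_poly h / (1 - fps_X) ^ (CARD('n) + 1)"

lemma is_h_star_poly_unique:
  fixes P :: "(real ^ 'n) set"
  assumes "is_h_star_poly h P" and "is_h_star_poly h' P"
  shows "h = h'"
proof -
  let ?D = "(1 - fps_X :: real fps) ^ (CARD('n) + 1)"
  have D: "is_unit ?D"
    by (simp add: fps_is_unit_iff)
  have "fps_of_poly h / ?D = fps_of_poly h' / ?D"
    using assms unfolding is_h_star_poly_def by metis
  then have "fps_of_poly h = fps_of_poly h'"
    using D by (metis unit_div_cancel)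
  then show ?thesis
    by (simp only: fps_of_poly_eq_iff)
qed

text \<open>
  The type argument \<open>'n\<close> fixes the dimension \<open>d = CARD('n)\<close>; the inequality is
  represented by its coefficients \<open>\<alpha> 1, \<dots>, \<alpha> d\<close>, and the other values of \<open>\<alpha>\<close>
  are irrelevant.
\<close>

definition strictly_balanced_inequality :: "'n::finite itself \<Rightarrow> (nat \<Rightarrow> real) \<Rightarrow> bool" where
  "strictly_balanced_inequality d \<alpha> \<longleftrightarrow>
     (\<Sum>i = 1..CARD('n). \<alpha> i) = 0 \<and>
     (\<forall>(P :: (real ^ 'n) set) h.
        lattice_polytope P \<and> aff_dim P = int CARD('n) \<and>
        interior P \<inter> lattice_points \<noteq> {} \<and> is_h_star_poly h P \<longrightarrow>
        (\<Sum>i = 1..CARD('n). \<alpha> i * coeff h i) \<ge> 0)"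

end

theory Submission
  imports Defs
begin

text \<open>
  Modulo the all-ones vector, on which a strictly balanced functional vanishes, the cone cut out
  by the inequalities is pointed, with six extreme rays. Each ray is exactly realised by the
  h*-vector of a lattice simplex with an interior lattice point, so a functional that is
  nonnegative on these six simplices is nonnegative on the whole cone.

  For the simplex with vertices \<open>0\<close>, the \<open>e i\<close> with \<open>i \<noteq> p\<close>, and \<open>N * e p - (\<Sum>i\<noteq>p. c i * e i)\<close>,
  where \<open>c p = 1\<close>, the lattice points of the half-open fundamental parallelepiped form a cyclic
  group of order \<open>N\<close>: its \<open>k\<close>-th element has the fractional parts of \<open>k * c i / N\<close> as
  barycentric coordinates, and its height is the sum of these rounded up. Hence h* is the
  generating polynomial of the heights.
\<close>

section \<open>Cyclic simplices and the heights of their box points\<close>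

definition shear_map :: "('n \<Rightarrow> nat) \<Rightarrow> nat \<Rightarrow> 'n \<Rightarrow> real ^ 'n \<Rightarrow> real ^ 'n" where
  "shear_map c N p y = (\<chi> i. if i = p then real N * y $ p else y $ i - real (c i) * y $ p)"

definition cyclic_simplex :: "('n \<Rightarrow> nat) \<Rightarrow> nat \<Rightarrow> 'n \<Rightarrow> (real ^ 'n) set" where
  "cyclic_simplex c N p = shear_map c N p ` (convex hull (insert 0 Basis))"

text \<open>Adding \<open>N - 1\<close> makes \<open>div\<close> round up.\<close>

definition box_height :: "('n::finite \<Rightarrow> nat) \<Rightarrow> nat \<Rightarrow> nat \<Rightarrow> nat" where
  "box_height c N k = ((\<Sum>i\<in>UNIV. k * c i mod N) + N - 1) div N"

section \<open>Geometry of the simplices: coordinates, lattice vertices, an interior lattice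
  point\<close>

lemma sum_inner_Basis_cart: "sum ((\<bullet>) y) Basis = (\<Sum>i\<in>UNIV. y $ i)" for y :: "real ^ 'n"
  by (simp add: Basis_vec_def UNION_singleton_eq_range sum.reindex inj_on_def axis_eq_axis inner_axis)

lemma std_simplex_cart:
  "convex hull (insert 0 Basis) = {y :: real ^ 'n. (\<forall>i. 0 \<le> y $ i) \<and> (\<Sum>i\<in>UNIV. y $ i) \<le> 1}"
  unfolding std_simplex sum_inner_Basis_cart by (auto simp: Basis_vec_def inner_axis)

lemma interior_std_simplex_cart:
  "interior (convex hull (insert 0 Basis)) = {y :: real ^ 'n. (\<forall>i. 0 < y $ i) \<and> (\<Sum>i\<in>UNIV. y $ i) < 1}"
  unfolding interior_std_simplex sum_inner_Basis_cart by (auto simp: Basis_vec_def inner_axis)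

lemma linear_shear_map: "linear (shear_map c N p)"
  by (rule linearI) (auto simp: shear_map_def vec_eq_iff algebra_simps)

lemma inj_shear_map:
  assumes "N > 0"
  shows "inj (shear_map c N p)"
proof (rule injI)
  fix x y :: "real ^ 'a"
  assume eq: "shear_map c N p x = shear_map c N p y"
  have "x $ p = y $ p"
    using arg_cong[OF eq, of "\<lambda>v. v $ p"] assms by (simp add: shear_map_def)
  moreover have "x $ i = y $ i" if "i \<noteq> p" for i
    using arg_cong[OF eq, of "\<lambda>v. v $ i"] that \<open>x $ p = y $ p\<close> by (simp add: shear_map_def)
  ultimately show "x = y"
    by (metis vec_eq_iff)
qed

lemma lattice_polytope_cyclic_simplex:
  fixes c :: "'n::finite \<Rightarrow> nat"
  shows "lattice_polytope (cyclic_simplex c N p)"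
  unfolding lattice_polytope_def
proof (intro conjI allI impI)
  have hull: "cyclic_simplex c N p = convex hull (shear_map c N p ` insert 0 Basis)"
    by (simp only: cyclic_simplex_def convex_hull_linear_image[OF linear_shear_map])
  show "polytope (cyclic_simplex c N p)"
    unfolding hull by (rule polytope_convex_hull) simp
  fix v assume "v extreme_point_of cyclic_simplex c N p"
  then have "v \<in> shear_map c N p ` insert 0 Basis"
    unfolding hull by (rule extreme_point_of_convex_hull)
  then show "v \<in> lattice_points"
    by (auto simp: lattice_points_def shear_map_def Basis_vec_def axis_def)
qed

text \<open>The point \<open>axis p 1\<close> is the sheared image of the box point with coordinates
  \<open>c i / N\<close>. Positive weights with sum below \<open>N\<close> put that point inside the
  open standard simplex.\<close>

lemma axis_in_interior_cyclic_simplex: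
  fixes c :: "'n::finite \<Rightarrow> nat"
  assumes "c p = 1" "\<And>i. c i > 0" "(\<Sum>i\<in>UNIV. c i) < N"
  shows "axis p 1 \<in> interior (cyclic_simplex c N p)"
proof -
  have N: "N > 0"
    using assms(3) by simp
  define y :: "real ^ 'n" where "y = (\<chi> i. real (c i) / real N)"
  have "(\<Sum>i\<in>UNIV. y $ i) = real (\<Sum>i\<in>UNIV. c i) / real N"
    by (simp add: y_def sum_divide_distrib)
  also have "\<dots> < 1"
    using assms(3) N by (simp del: of_nat_sum)
  finally have "y \<in> interior (convex hull (insert 0 Basis))"
    using assms(2) N by (simp add: interior_std_simplex_cart y_def)
  moreover have "shear_map c N p y = axis p 1"
    using assms(1) N by (auto simp: shear_map_def y_def vec_eq_iff axis_def)
  moreover have "interior (cyclic_simplex c N p)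
      = shear_map c N p ` interior (convex hull (insert 0 Basis))"
    unfolding cyclic_simplex_def
    by (rule interior_injective_linear_image[OF linear_shear_map inj_shear_map[OF N]])
  ultimately show ?thesis
    by (metis imageI)
qed

section \<open>Lattice points in the dilates\<close>

lemma scaled_cyclic_simplex:
  fixes c :: "'n::finite \<Rightarrow> nat"
  shows "(\<lambda>x. real m *\<^sub>R x) ` cyclic_simplex c N p
    = shear_map c N p ` {y. (\<forall>i. 0 \<le> y $ i) \<and> (\<Sum>i\<in>UNIV. y $ i) \<le> real m}"
proof -
  have "(\<lambda>x. real m *\<^sub>R x) ` (convex hull (insert 0 Basis))
      = {y :: real ^ 'n. (\<forall>i. 0 \<le> y $ i) \<and> (\<Sum>i\<in>UNIV. y $ i) \<le> real m}" (is "_ = ?R")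
  \<comment> \<open>For positive \<open>m\<close> the scaling is undone by \<open>1 / m\<close>.
    Dilation by 0 has no inverse, so there both sides are computed to be \<open>{0}\<close>.\<close>
  proof (cases "m = 0")
    case True
    have "?R = {0}"
    proof (intro equalityI subsetI)
      fix y assume y: "y \<in> ?R"
      have "y $ i = 0" for i
      proof -
        have "y $ i \<le> (\<Sum>i\<in>UNIV. y $ i)"
          using y by (intro member_le_sum) auto
        with y True show ?thesis
          by (metis (mono_tags, lifting) mem_Collect_eq of_nat_0 order.trans order_antisym)
      qed
      then show "y \<in> {0}"
        by (simp add: vec_eq_iff)
    qed (use True in auto)
    moreover have "(0::real ^ 'n) \<in> convex hull (insert 0 Basis)"
      by (rule hull_inc) simp
    ultimately show ?thesis
      using True by auto
  next
    case False
    show ?thesis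
    proof (intro equalityI subsetI)
      fix y assume y: "y \<in> ?R"
      have "(1 / real m) *\<^sub>R y \<in> convex hull (insert 0 Basis)"
        using y False by (simp add: std_simplex_cart sum_divide_distrib[symmetric])
      moreover have "y = real m *\<^sub>R ((1 / real m) *\<^sub>R y)"
        using False by simp
      ultimately show "y \<in> (\<lambda>x. real m *\<^sub>R x) ` (convex hull (insert 0 Basis))"
        by blast
    next
      fix y assume "y \<in> (\<lambda>x. real m *\<^sub>R x) ` (convex hull (insert 0 Basis :: (real ^ 'n) set))"
      then show "y \<in> ?R"
        unfolding std_simplex_cart
        by (auto simp: sum_distrib_left[symmetric] mult_left_le)
    qed
  qed
  moreover have "(\<lambda>x. real m *\<^sub>R x) ` cyclic_simplex c N p
      = shear_map c N p ` (\<lambda>x. real m *\<^sub>R x) ` (convex hull (insert 0 Basis))"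
    by (simp add: cyclic_simplex_def image_image linear_cmul[OF linear_shear_map])
  ultimately show ?thesis
    by simp
qed

text \<open>A natural number bounds a fraction from above exactly when it bounds the fraction
  rounded up. This trades the bound on the coordinate sum of a lattice point for one on its integer
  parts plus a height.\<close>

lemma add_box_height_le_iff:
  assumes "N > 0"
  shows "s + box_height c N k \<le> m \<longleftrightarrow> s * N + (\<Sum>i\<in>UNIV. k * c i mod N) \<le> m * N"
proof -
  define t where "t = (\<Sum>i\<in>UNIV. k * c i mod N)"
  have "s + box_height c N k = (s * N + t + N - 1) div N"
  proof -
    have "s * N + t + N - 1 = t + N - 1 + s * N"
      using assms by simp
    then show ?thesis
      using assms by (simp only: box_height_def t_def div_mult_self1)
  qed
  \<comment> \<open>A quotient is at most \<open>m\<close> iff the numerator is below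
    \<open>(m + 1) * N\<close>; the offset \<open>N - 1\<close> then turns the strict bound into a
    weak one.\<close>
  also have "\<dots> \<le> m \<longleftrightarrow> s * N + t + N - 1 < (m + 1) * N"
    using assms by (metis Suc_eq_plus1 less_Suc_eq_le div_less_iff_less_mult)
  also have "\<dots> \<longleftrightarrow> s * N + t \<le> m * N"
    using assms by auto
  finally show ?thesis
    by (simp add: t_def)
qed

lemma box_height_le_card:
  fixes c :: "'n::finite \<Rightarrow> nat"
  assumes "N > 0"
  shows "box_height c N k \<le> CARD('n)"
proof -
  have "(\<Sum>i\<in>(UNIV::'n set). k * c i mod N) \<le> (\<Sum>i\<in>(UNIV::'n set). N)"
    using assms by (intro sum_mono) (simp add: less_imp_le)
  then show ?thesis
    using add_box_height_le_iff[OF assms, of 0 c k "CARD('n)"] by simp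
qed

text \<open>Undoing the shear on a lattice point gives coordinates in the dilated standard simplex.
  They split uniquely into integer parts \<open>z\<close> and the fractional parts
  \<open>(k * c i mod N) / N\<close> of one box element \<open>k\<close>.\<close>

lemma lattice_count_cyclic_simplex:
  fixes c :: "'n::finite \<Rightarrow> nat"
  assumes N: "N > 0" and p: "c p = 1"
  shows "lattice_count (cyclic_simplex c N p) m
    = card (SIGMA k:{..<N}. {z :: 'n \<Rightarrow> nat. (\<Sum>i\<in>UNIV. z i) + box_height c N k \<le> m})"
proof -
  define y :: "nat \<times> ('n \<Rightarrow> nat) \<Rightarrow> real ^ 'n" where
    "y = (\<lambda>(k, z). \<chi> i. real (z i * N + k * c i mod N) / real N)"
  let ?f = "shear_map c N p"
  let ?A = "SIGMA k:{..<N}. {z :: 'n \<Rightarrow> nat. (\<Sum>i\<in>UNIV. z i) + box_height c N k \<le> m}"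
  have inj: "inj_on (?f \<circ> y) ?A"
  proof (rule comp_inj_on)
    show "inj_on y ?A"
    proof (rule inj_onI, clarify)
      fix k z k' z'
      assume k: "k < N" "k' < N" and "y (k, z) = y (k', z')"
      then have eq: "z i * N + k * c i mod N = z' i * N + k' * c i mod N" for i
        using N by (simp add: y_def vec_eq_iff)
          (metis of_nat_add of_nat_eq_iff of_nat_mult)
      \<comment> \<open>The weight at \<open>p\<close> is 1, so the residue there is the index
        itself; once the indices agree, the quotients determine \<open>z\<close>.\<close>
      have "k = k'"
        using arg_cong[OF eq[of p], of "\<lambda>x. x mod N"] k p by simp
      moreover have "z i = z' i" for i
        using arg_cong[OF eq[of i], of "\<lambda>x. x div N"] N by simp
      ultimately show "k = k' \<and> z = z'"
        by auto
    qed
    show "inj_on ?f (y ` ?A)"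
      using inj_shear_map[OF N] by (rule inj_on_subset) simp
  qed
  have "(?f \<circ> y) ` ?A = (\<lambda>x. real m *\<^sub>R x) ` cyclic_simplex c N p \<inter> lattice_points"
  proof (intro equalityI subsetI)
    fix x assume "x \<in> (?f \<circ> y) ` ?A"
    then obtain k z where k: "k < N" and le: "(\<Sum>i\<in>UNIV. z i) + box_height c N k \<le> m"
      and x: "x = ?f (y (k, z))"
      by auto
    have "(\<Sum>i\<in>UNIV. y (k, z) $ i) = real ((\<Sum>i\<in>UNIV. z i) * N + (\<Sum>i\<in>UNIV. k * c i mod N)) / real N"
      by (simp add: y_def sum_divide_distrib sum.distrib add_divide_distrib sum_distrib_right)
    also have "\<dots> \<le> real m"
      using le[unfolded add_box_height_le_iff[OF N]] N
      by (simp add: divide_le_eq flip: of_nat_mult of_nat_add of_nat_sum)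
    finally have "x \<in> (\<lambda>x. real m *\<^sub>R x) ` cyclic_simplex c N p"
      unfolding scaled_cyclic_simplex x by (auto simp: y_def)
    moreover have "x $ i \<in> \<int>" for i
    proof (cases "i = p")
      case True
      then have "x $ i = real (z p * N + k)"
        using N k p by (simp add: x shear_map_def y_def)
      then show ?thesis
        by (metis Ints_of_nat)
    next
      case False
      \<comment> \<open>Reduction modulo \<open>N\<close> changes the coordinate only by an integer,
        and the remaining fraction \<open>c i * k / N\<close> is exactly what the shear
        subtracts.\<close>
      have "real (k * c i mod N) = real (k * c i) - real (k * c i div N) * real N"
        by (metis add_diff_cancel_left' div_mult_mod_eq of_nat_add of_nat_mult)
      then have q: "real (k * c i mod N) / real N = real (c i) * (real k / real N) - real (k * c i div N)"
        using N by (simp add: field_simps)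
      have "y (k, z) $ i = real (z i) + real (k * c i mod N) / real N"
        "y (k, z) $ p = real (z p) + real k / real N"
        using N k p by (simp_all add: y_def add_divide_distrib)
      then have "x $ i = real (z i) + real (k * c i mod N) / real N - real (c i) * (real (z p) + real k / real N)"
        using False by (simp add: x shear_map_def)
      also have "\<dots> = real (z i) - real (c i) * real (z p) - real (k * c i div N)"
        unfolding q distrib_left by linarith
      finally have "x $ i = real (z i) - real (c i) * real (z p) - real (k * c i div N)" .
      then show ?thesis
        by simp
    qed
    ultimately show "x \<in> (\<lambda>x. real m *\<^sub>R x) ` cyclic_simplex c N p \<inter> lattice_points"
      by (auto simp: lattice_points_def)
  next
    fix x assume x: "x \<in> (\<lambda>x. real m *\<^sub>R x) ` cyclic_simplex c N p \<inter> lattice_points"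
    then obtain w where w: "x = ?f w" "\<And>i. 0 \<le> w $ i" "(\<Sum>i\<in>UNIV. w $ i) \<le> real m"
      unfolding scaled_cyclic_simplex by auto
    have int: "x $ i \<in> \<int>" for i
      using x by (auto simp: lattice_points_def)
    \<comment> \<open>Inverting the shear gives \<open>N * w $ p = x $ p\<close> and, for the other
      \<open>i\<close>, \<open>N * w $ i = N * x $ i + c i * x $ p\<close>. Thus every
      \<open>N * w $ i\<close> is a nonnegative integer congruent to \<open>c i * x $ p\<close>
      modulo \<open>N\<close>, and \<open>x $ p\<close> modulo \<open>N\<close> is the box
      index.\<close>
    have "\<exists>u. real N * w $ i = real u \<and> u mod N = nat (\<lfloor>x $ p\<rfloor> mod int N) * c i mod N" for i
    proof -
      have xp: "real N * w $ p = x $ p"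
        by (simp add: w shear_map_def)
      have "\<exists>b. real N * w $ i = of_int (\<lfloor>x $ p\<rfloor> * int (c i) + b * int N)"
      proof (cases "i = p")
        case True
        then show ?thesis
          using xp int[of p] p by (intro exI[of _ 0]) simp
      next
        case False
        have "of_int (\<lfloor>x $ p\<rfloor> * int (c i) + \<lfloor>x $ i\<rfloor> * int N) = x $ p * real (c i) + x $ i * real N"
          using int by simp
        also have "\<dots> = (real N * w $ p) * real (c i) + (w $ i - real (c i) * w $ p) * real N"
          using False by (simp add: w(1) shear_map_def)
        also have "\<dots> = real N * w $ i"
          by (simp add: algebra_simps)
        finally have "real N * w $ i = of_int (\<lfloor>x $ p\<rfloor> * int (c i) + \<lfloor>x $ i\<rfloor> * int N)" ..
        then show ?thesis
          by blast
      qed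
      then obtain b where b: "real N * w $ i = of_int (\<lfloor>x $ p\<rfloor> * int (c i) + b * int N)"
        by blast
      define a where "a = \<lfloor>x $ p\<rfloor> * int (c i) + b * int N"
      have "a \<ge> 0"
        using b w(2)[of i] unfolding a_def[symmetric]
        by (metis of_int_0_le_iff of_nat_0_le_iff zero_le_mult_iff)
      moreover have "a mod int N = int (nat (\<lfloor>x $ p\<rfloor> mod int N) * c i mod N)"
        using N by (simp add: a_def of_nat_mod mod_mult_left_eq)
      ultimately have "real N * w $ i = real (nat a) \<and> nat a mod N = nat (\<lfloor>x $ p\<rfloor> mod int N) * c i mod N"
        using b unfolding a_def[symmetric]
        by (metis nat_int nat_mod_distrib of_nat_0_le_iff of_nat_nat)
      then show ?thesis
        by blast
    qed
    then obtain u where u: "\<And>i. real N * w $ i = real (u i)"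
        "\<And>i. u i mod N = nat (\<lfloor>x $ p\<rfloor> mod int N) * c i mod N"
      by metis
    define k where "k = nat (\<lfloor>x $ p\<rfloor> mod int N)"
    define z where "z = (\<lambda>i. u i div N)"
    have k: "k < N"
      using N by (simp add: k_def nat_less_iff)
    have uz: "z i * N + k * c i mod N = u i" for i
      by (simp only: z_def k_def u(2)[symmetric] div_mult_mod_eq)
    have "w $ i = real (u i) / real N" for i
      using N u(1)[of i] by (simp add: field_simps)
    then have "w = y (k, z)"
      by (simp only: y_def vec_eq_iff uz vec_lambda_beta prod.case) simp
    moreover have "(\<Sum>i\<in>UNIV. z i) * N + (\<Sum>i\<in>UNIV. k * c i mod N) = (\<Sum>i\<in>UNIV. u i)"
      by (simp add: sum_distrib_right uz flip: sum.distrib)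
    moreover have "real (\<Sum>i\<in>UNIV. u i) = real N * (\<Sum>i\<in>UNIV. w $ i)"
      by (simp add: u(1) sum_distrib_left)
    then have "real (\<Sum>i\<in>UNIV. u i) \<le> real (m * N)"
      using w(3) N by simp
    then have "(\<Sum>i\<in>UNIV. u i) \<le> m * N"
      by (simp only: of_nat_le_iff)
    ultimately have "(k, z) \<in> ?A"
      using k by (simp add: add_box_height_le_iff[OF N])
    with w(1) \<open>w = y (k, z)\<close> show "x \<in> (?f \<circ> y) ` ?A"
      by force
  qed
  then show ?thesis
    unfolding lattice_count_def using card_image[OF inj] by (simp only:)
qed

section \<open>Generating function of the dilated standard simplex\<close>

lemma finite_sum_le:
  fixes M :: nat
  assumes "finite A"
  shows "finite {z. (\<forall>i. i \<notin> A \<longrightarrow> z i = (0::nat)) \<and> sum z A \<le> M}"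
proof (rule finite_subset)
  show "{z. (\<forall>i. i \<notin> A \<longrightarrow> z i = 0) \<and> sum z A \<le> M}
      \<subseteq> {z. \<forall>i. (i \<in> A \<longrightarrow> z i \<in> {..M}) \<and> (i \<notin> A \<longrightarrow> z i = 0)}"
    using assms by (auto intro: order.trans[OF member_le_sum])
  show "finite {z. \<forall>i. (i \<in> A \<longrightarrow> z i \<in> {..M}) \<and> (i \<notin> A \<longrightarrow> z i = (0::nat))}"
    using assms by (rule finite_set_of_finite_funs) simp
qed

text \<open>Induction on the set of free coordinates: freeing one more replaces the counts by their
  partial sums, which divides the series by \<open>1 - fps_X\<close>. With no free coordinate the
  counts are constantly 1. Fixing zeros outside \<open>A\<close> keeps all stages in one function
  type.\<close>

lemma card_sum_le_fps:
  assumes "finite A"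
  shows "Abs_fps (\<lambda>M. of_nat (card {z. (\<forall>i. i \<notin> A \<longrightarrow> z i = (0::nat)) \<and> sum z A \<le> M}))
    = inverse ((1 - fps_X :: 'a::field fps) ^ (card A + 1))"
  using assms
proof (induction A rule: finite_induct)
  case empty
  have "{z. (\<forall>i. z i = 0)} = {\<lambda>i::'b. 0::nat}"
    by auto
  then show ?case
    by (simp add: fps_inverse_one_minus_fps_X)
next
  case (insert a A)
  define S where "S = (\<lambda>B M. {z :: 'b \<Rightarrow> nat. (\<forall>i. i \<notin> B \<longrightarrow> z i = 0) \<and> sum z B \<le> M})"
  have "card (S (insert a A) M) = (\<Sum>j\<in>{0..M}. card (S A j))" for M
  proof -
    \<comment> \<open>\<open>j\<close> is the part of the budget \<open>M\<close> left over by the coordinate \<open>a\<close>.\<close>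
    have bij: "bij_betw (\<lambda>(j, z). z(a := M - j)) (SIGMA j:{0..M}. S A j) (S (insert a A) M)"
    proof (rule bij_betw_byWitness[where f' = "\<lambda>z. (M - z a, z(a := 0))"])
      have upd: "(\<Sum>i\<in>A. if i = a then v else z i) = sum z A" for z :: "'b \<Rightarrow> nat" and v
        using insert.hyps by (intro sum.cong) auto
      show "\<forall>x\<in>SIGMA j:{0..M}. S A j. (case case x of (j, z) \<Rightarrow> z(a := M - j) of z \<Rightarrow> (M - z a, z(a := 0))) = x"
        using insert.hyps by (auto simp: S_def fun_eq_iff)
      show "\<forall>z\<in>S (insert a A) M. (case (M - z a, z(a := 0)) of (j, z) \<Rightarrow> z(a := M - j)) = z"
        using insert.hyps by (auto simp: S_def fun_eq_iff)
      show "(\<lambda>(j, z). z(a := M - j)) ` (SIGMA j:{0..M}. S A j) \<subseteq> S (insert a A) M"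
        using insert.hyps by (auto simp: S_def upd)
      show "(\<lambda>z. (M - z a, z(a := 0))) ` S (insert a A) M \<subseteq> (SIGMA j:{0..M}. S A j)"
        using insert.hyps by (auto simp: S_def upd)
    qed
    have "card (SIGMA j:{0..M}. S A j) = (\<Sum>j\<in>{0..M}. card (S A j))"
      using finite_sum_le[OF insert.hyps(1)] by (intro card_SigmaI) (auto simp: S_def)
    with bij_betw_same_card[OF bij] show ?thesis
      by simp
  qed
  then have "Abs_fps (\<lambda>M. of_nat (card (S (insert a A) M)))
      = Abs_fps (\<lambda>M. of_nat (card (S A M))) / (1 - fps_X :: 'a fps)"
    by (simp add: fps_divide_fps_X_minus1_sum)
  also have "\<dots> = inverse ((1 - fps_X) ^ (card A + 1)) * inverse (1 - fps_X)"
    using insert.IH by (simp add: S_def fps_divide_unit)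
  also have "\<dots> = inverse ((1 - fps_X) ^ (card (insert a A) + 1))"
    using insert.hyps by (simp add: fps_inverse_mult mult.assoc flip: fps_inverse_power)
  finally show ?case
    by (simp add: S_def)
qed

section \<open>The h*-polynomial of a cyclic simplex\<close>

text \<open>Each box element contributes the series \<open>F\<close> of the standard simplex,
  delayed by its height. Summing over the box multiplies \<open>F\<close> by the generating
  polynomial of the heights.\<close>

lemma is_h_star_poly_cyclic_simplex:
  fixes c :: "'n::finite \<Rightarrow> nat"
  assumes N: "N > 0" and p: "c p = 1"
  shows "is_h_star_poly (\<Sum>k<N. monom 1 (box_height c N k)) (cyclic_simplex c N p)"
  unfolding is_h_star_poly_def
proof
  show "degree (\<Sum>k<N. monom (1::real) (box_height c N k)) \<le> CARD('n)"
    by (intro degree_sum_le) (auto intro: order.trans[OF degree_monom_le box_height_le_card[OF N]])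
  define F :: "real fps" where "F = inverse ((1 - fps_X) ^ (CARD('n) + 1))"
  have F: "fps_nth F M = card {z :: 'n \<Rightarrow> nat. sum z UNIV \<le> M}" for M
    using arg_cong[OF card_sum_le_fps[of "UNIV :: 'n set", where ?'a = real], of "\<lambda>G. fps_nth G M"]
    by (simp add: F_def)
  have "real (lattice_count (cyclic_simplex c N p) m)
      = fps_nth (fps_of_poly (\<Sum>k<N. monom 1 (box_height c N k)) * F) m" for m
  proof -
    have fin: "finite {z :: 'n \<Rightarrow> nat. (\<Sum>i\<in>UNIV. z i) + s \<le> m}" for s
      by (rule finite_subset[OF _ finite_sum_le[of UNIV m]]) auto
    have "real (lattice_count (cyclic_simplex c N p) m)
        = (\<Sum>k<N. real (card {z :: 'n \<Rightarrow> nat. (\<Sum>i\<in>UNIV. z i) + box_height c N k \<le> m}))"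
      using fin by (simp add: lattice_count_cyclic_simplex[where c = c, OF N p])
    also have "\<dots> = (\<Sum>k<N. fps_nth (fps_X ^ box_height c N k * F) m)"
    proof (rule sum.cong)
      fix k
      \<comment> \<open>Subtraction truncates at 0, so dilates with \<open>m\<close> below the
        height, which contain no such points, are split off.\<close>
      have "{z :: 'n \<Rightarrow> nat. (\<Sum>i\<in>UNIV. z i) + box_height c N k \<le> m}
          = (if m < box_height c N k then {} else {z. sum z UNIV \<le> m - box_height c N k})"
        by auto
      then show "real (card {z :: 'n \<Rightarrow> nat. (\<Sum>i\<in>UNIV. z i) + box_height c N k \<le> m})
          = fps_nth (fps_X ^ box_height c N k * F) m"
        by (simp add: fps_X_power_mult_nth F)
    qed simp
    also have "\<dots> = fps_nth (fps_of_poly (\<Sum>k<N. monom 1 (box_height c N k)) * F) m"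
      by (simp add: fps_of_poly_sum fps_of_poly_monom' sum_distrib_right fps_sum_nth)
    finally show ?thesis .
  qed
  then show "Abs_fps (\<lambda>m. real (lattice_count (cyclic_simplex c N p) m)) =
      fps_of_poly (\<Sum>k<N. monom 1 (box_height c N k)) / (1 - fps_X) ^ (CARD('n) + 1)"
    by (subst fps_divide_unit) (auto simp: fps_eq_iff F_def)
qed

section \<open>Constraints that the simplices impose on a balanced inequality\<close>

text \<open>The functional is evaluated on h* one box element at a time. The element
  \<open>k = 0\<close> has height 0 and enters only the constant coefficient, which the inequality
  omits; all others have positive height.\<close>

lemma strictly_balanced_cyclic_simplex:
  fixes c :: "'n::finite \<Rightarrow> nat"
  assumes "strictly_balanced_inequality TYPE('n) \<alpha>"
    and "c p = 1" "\<And>i. c i > 0" "(\<Sum>i\<in>UNIV. c i) < N"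
  shows "(\<Sum>k = 1..<N. \<alpha> (box_height c N k)) \<ge> 0"
proof -
  let ?P = "cyclic_simplex c N p" and ?h = "\<Sum>k<N. monom (1::real) (box_height c N k)"
  have N: "N > 0"
    using assms(4) by simp
  have int: "axis p 1 \<in> interior ?P"
    using assms by (intro axis_in_interior_cyclic_simplex)
  then have "aff_dim ?P = int CARD('n)"
    by (subst aff_dim_nonempty_interior) auto
  moreover have "axis p 1 \<in> lattice_points"
    by (simp add: lattice_points_def axis_def)
  ultimately have "(\<Sum>i = 1..CARD('n). \<alpha> i * coeff ?h i) \<ge> 0"
    using assms N int lattice_polytope_cyclic_simplex is_h_star_poly_cyclic_simplex[of N c p]
    unfolding strictly_balanced_inequality_def by blast
  also have "(\<Sum>i = 1..CARD('n). \<alpha> i * coeff ?h i)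
      = (\<Sum>k<N. \<Sum>i = 1..CARD('n). if box_height c N k = i then \<alpha> i else 0)"
    by (subst sum.swap) (simp add: coeff_sum sum_distrib_left if_distrib cong: if_cong)
  also have "\<dots> = (\<Sum>k<N. if box_height c N k = 0 then 0 else \<alpha> (box_height c N k))"
    using box_height_le_card[OF N, of c] by (intro sum.cong) (auto simp: Suc_le_eq)
  also have "\<dots> = (\<Sum>k = 1..<N. \<alpha> (box_height c N k))"
  proof (rule sum.mono_neutral_cong_right)
    show "\<forall>k\<in>{..<N} - {1..<N}. (if box_height c N k = 0 then 0 else \<alpha> (box_height c N k)) = 0"
      using N by (auto simp: box_height_def Suc_le_eq)
    fix k assume k: "k \<in> {1..<N}"
    \<comment> \<open>As \<open>c p = 1\<close>, this residue is \<open>k\<close> itself, so the sum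
      that is rounded up is positive.\<close>
    then have "0 < k * c p mod N"
      using assms(2) by simp
    also have "\<dots> \<le> (\<Sum>i\<in>UNIV. k * c i mod N)"
      by (rule member_le_sum) auto
    finally have "box_height c N k \<noteq> 0"
      using add_box_height_le_iff[OF N, of 0 c k 0]
      by (metis add_0 le_zero_eq less_irrefl mult_0)
    then show "(if box_height c N k = 0 then 0 else \<alpha> (box_height c N k)) = \<alpha> (box_height c N k)"
      by simp
  qed auto
  finally show ?thesis .
qed

text \<open>Five weights 1 and one weight \<open>q\<close> are enough to realise all six rays. For
  \<open>k < N\<close> each unit weight contributes \<open>k\<close>, which leaves heights that
  evaluate by plain arithmetic.\<close>

lemma strictly_balanced_weights_6:
  assumes "strictly_balanced_inequality TYPE(6) \<alpha>" "0 < q" "q + 5 < N"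
  shows "(\<Sum>k = 1..<N. \<alpha> ((5 * k + k * q mod N + N - 1) div N)) \<ge> 0"
proof -
  define c :: "6 \<Rightarrow> nat" where "c = (\<lambda>i. if i = 1 then q else 1)"
  have *: "(\<Sum>i\<in>(UNIV::6 set). if i = 1 then a else b) = a + 5 * b" for a b :: nat
    by (simp add: sum.If_cases Compl_eq_Diff_UNIV card_Diff_singleton)
  \<comment> \<open>The weight \<open>q\<close> sits at index 1, so index 0 can serve as the
    position \<open>p\<close> of weight 1.\<close>
  have "(\<Sum>k = 1..<N. \<alpha> (box_height c N k)) \<ge> 0"
    using assms(2,3) by (intro strictly_balanced_cyclic_simplex[OF assms(1), of c 0]) (auto simp: c_def *)
  also have "(\<Sum>k = 1..<N. \<alpha> (box_height c N k))
      = (\<Sum>k = 1..<N. \<alpha> ((5 * k + k * q mod N + N - 1) div N))"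
  proof (rule sum.cong)
    fix k assume "k \<in> {1..<N}"
    then have "(\<Sum>i\<in>UNIV. k * c i mod N) = (\<Sum>i\<in>(UNIV::6 set). if i = 1 then k * q mod N else k)"
      by (intro sum.cong) (auto simp: c_def)
    then show "\<alpha> (box_height c N k) = \<alpha> ((5 * k + k * q mod N + N - 1) div N)"
      by (simp only: box_height_def *) (simp only: add.commute)
  qed simp
  finally show ?thesis .
qed

section \<open>Decomposition of the cone in dimension 6\<close>

theorem theorem1p21:
  fixes \<alpha> :: "nat \<Rightarrow> real"
  assumes "strictly_balanced_inequality TYPE(6) \<alpha>"
  shows "\<forall>h :: nat \<Rightarrow> real.
           (h 6 \<le> h 1 \<and> h 1 \<le> h 5 \<and> h 5 \<le> h 2) \<and>
           (h 1 + h 2 \<le> h 4 + h 5 \<and> h 4 + h 5 \<le> h 2 + h 3) \<and>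
           h 1 + h 2 \<le> h 3 + h 4 \<longrightarrow>
           (\<Sum>i = 1..6. \<alpha> i * h i) \<ge> 0"
proof (intro allI impI)
  fix h :: "nat \<Rightarrow> real"
  assume h: "(h 6 \<le> h 1 \<and> h 1 \<le> h 5 \<and> h 5 \<le> h 2) \<and>
           (h 1 + h 2 \<le> h 4 + h 5 \<and> h 4 + h 5 \<le> h 2 + h 3) \<and>
           h 1 + h 2 \<le> h 3 + h 4"
  have range: "{1..6} = {1, 2, 3, 4, 5, 6::nat}"
    by auto
  have bal: "\<alpha> 1 + \<alpha> 2 + \<alpha> 3 + \<alpha> 4 + \<alpha> 5 + \<alpha> 6 = 0"
    using assms by (simp add: strictly_balanced_inequality_def range del: One_nat_def)
  note simplex = strictly_balanced_weights_6[OF assms]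
  \<comment> \<open>The six simplices are listed in the order of the rays. Each height count is the
    ray plus the all-ones vector, taken twice for \<open>N = 19\<close>, and \<open>bal\<close>
    removes the latter.\<close>
  have rays: "\<alpha> 1 + \<alpha> 2 + \<alpha> 3 + \<alpha> 4 + \<alpha> 5 \<ge> 0" "\<alpha> 2 + \<alpha> 4 \<ge> 0" "\<alpha> 3 + \<alpha> 4 \<ge> 0"
    "\<alpha> 3 \<ge> 0" "2 * \<alpha> 2 + \<alpha> 3 + \<alpha> 4 + 2 * \<alpha> 5 \<ge> 0" "\<alpha> 2 + \<alpha> 3 + \<alpha> 5 \<ge> 0"
    using simplex[of 1 12] simplex[of 1 9] simplex[of 2 9] simplex[of 1 8] simplex[of 4 19]
      simplex[of 1 10] bal
    by (simp_all add: sum.atLeast_Suc_lessThan)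
  \<comment> \<open>The cone is not simplicial; \<open>s\<close> and \<open>r\<close> distribute \<open>h 5 - h 1\<close> over the two rays
    on which it is nonzero.\<close>
  define s where "s = min (h 5 - h 1) (h 2 + h 3 - h 4 - h 5)"
  \<comment> \<open>This slack equals 1 on the third and fifth rays and 0 on the other four, so the
    third ray is left with coefficient \<open>d - r\<close>.\<close>
  define d where "d = h 4 + h 5 - h 1 - h 2"
  define r where "r = (h 5 - h 1 - s) / 2"
  \<comment> \<open>For \<open>d - r\<close>: if \<open>s\<close> is \<open>h 5 - h 1\<close>, then
    \<open>r = 0\<close> and \<open>d \<ge> 0\<close>. Otherwise
    \<open>2 * (d - r) = h 3 + h 4 - h 1 - h 2\<close>, which is nonnegative by the last inequality
    of the system.\<close>
  have nonneg: "h 1 - h 6 \<ge> 0" "h 2 - h 5 \<ge> 0" "d - r \<ge> 0" "h 2 + h 3 - h 4 - h 5 - s \<ge> 0" "r \<ge> 0" "s \<ge> 0"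
    using h by (auto simp: s_def d_def r_def min_def)
  \<comment> \<open>This is \<open>\<alpha>\<close> applied to \<open>h\<close> written as
    \<open>h 6\<close> times the all-ones vector plus a nonnegative combination of the rays.\<close>
  have "(\<Sum>i = 1..6. \<alpha> i * h i) = h 6 * (\<alpha> 1 + \<alpha> 2 + \<alpha> 3 + \<alpha> 4 + \<alpha> 5 + \<alpha> 6)
      + (h 1 - h 6) * (\<alpha> 1 + \<alpha> 2 + \<alpha> 3 + \<alpha> 4 + \<alpha> 5)
      + (h 2 - h 5) * (\<alpha> 2 + \<alpha> 4)
      + (d - r) * (\<alpha> 3 + \<alpha> 4)
      + (h 2 + h 3 - h 4 - h 5 - s) * \<alpha> 3
      + r * (2 * \<alpha> 2 + \<alpha> 3 + \<alpha> 4 + 2 * \<alpha> 5)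
      + s * (\<alpha> 2 + \<alpha> 3 + \<alpha> 5)"
    unfolding range by (simp add: d_def r_def field_simps del: One_nat_def)
  also have "\<dots> \<ge> 0"
    unfolding bal
    by (intro add_nonneg_nonneg mult_nonneg_nonneg[OF nonneg(1) rays(1)]
        mult_nonneg_nonneg[OF nonneg(2) rays(2)] mult_nonneg_nonneg[OF nonneg(3) rays(3)]
        mult_nonneg_nonneg[OF nonneg(4) rays(4)] mult_nonneg_nonneg[OF nonneg(5) rays(5)]
        mult_nonneg_nonneg[OF nonneg(6) rays(6)]) simp
  finally show "(\<Sum>i = 1..6. \<alpha> i * h i) \<ge> 0" .
qed

end
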